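(* Let $k\ge 1$ be an integer, let $p\in(0,1)$ and $q=1-p$. Let $N_k$ have the geometric distribution of order $k$ with success parameter $p$, with probability mass function $f_k(n)=P(N_k=n)$, and for each integer $r\ge 1$ let $\mu_{(r)}=\mathbb{E}[N_k(N_k-1)\cdots(N_k-r+1)]$ be its $r$-th factorial moment. Then for every integer $r\ge 1$, $$\mu_{(r)} = r!\,\frac{f_k\bigl((r+1)k+r\bigr)}{(qp^k)^{r+1}}.$$
   Context: Consider an infinite sequence of independent Bernoulli trials, each with probability $p\in(0,1)$ of success, and set $q=1-p$. For an integer $k\ge1$, let $N_k$ be the waiting time for the first run of $k$ consecutive successes, i.e. the index of the trial at which a run of $k$ consecutive successes is first completed (so $N_k\ge k$ and $P(N_k=k)=p^k$). The distribution of $N_k$ is called the geometric distribution of order $k$ with success parameter $p$; for $k=1$ it is the usual geometric distribution on $\{1,2,\dots\}$. *)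

theory Defs
  imports "HOL-Probability.Probability"
begin

text \<open>
  Trials are numbered from \<open>1\<close>; \<open>x i\<close> means that the \<open>i\<close>-th trial is a success.
\<close>

definition bernoulli_trials :: "real \<Rightarrow> (nat \<Rightarrow> bool) measure" where
  "bernoulli_trials p = (\<Pi>\<^sub>M i\<in>{1..}. measure_pmf (bernoulli_pmf p))"

definition run_completed_at :: "nat \<Rightarrow> (nat \<Rightarrow> bool) \<Rightarrow> nat \<Rightarrow> bool" where
  "run_completed_at k x n \<longleftrightarrow> k \<le> n \<and> (\<forall>i\<in>{n - k<..n}. x i)"

text \<open>
  The value \<open>0\<close> on sequences without a run of length \<open>k\<close> is immaterial: for \<open>0 < p < 1\<close> these
  sequences form a null set (\<open>AE_run_completed\<close> below).
\<close>

definition waiting_time :: "nat \<Rightarrow> (nat \<Rightarrow> bool) \<Rightarrow> nat" where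
  "waiting_time k x =
     (if \<exists>n. run_completed_at k x n then LEAST n. run_completed_at k x n else 0)"

definition geometric_order :: "nat \<Rightarrow> real \<Rightarrow> nat measure" where
  "geometric_order k p = distr (bernoulli_trials p) (count_space UNIV) (waiting_time k)"

definition factorial_moment :: "'a measure \<Rightarrow> ('a \<Rightarrow> nat) \<Rightarrow> nat \<Rightarrow> real" where
  "factorial_moment M N r = (\<integral>\<omega>. (\<Prod>i<r. real (N \<omega>) - real i) \<partial>M)"


text \<open>Well-definedness of the waiting time and its law.\<close>

lemma prob_space_bernoulli_trials: "prob_space (bernoulli_trials p)"
  unfolding bernoulli_trials_def by (intro prob_space_PiM measure_pmf.prob_space_axioms)

lemma measurable_run_completed_at [measurable]:
  "Measurable.pred (bernoulli_trials p) (\<lambda>x. run_completed_at k x n)"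
proof (cases "k \<le> n")
  case True
  have "Measurable.pred (bernoulli_trials p) (\<lambda>x. x i)" if "i \<in> {n - k<..n}" for i
  proof -
    have "(\<lambda>x. x i) \<in> measurable (bernoulli_trials p) (measure_pmf (bernoulli_pmf p))"
      unfolding bernoulli_trials_def using that by (intro measurable_component_singleton) auto
    then show ?thesis by simp
  qed
  then have "Measurable.pred (bernoulli_trials p) (\<lambda>x. \<forall>i\<in>{n - k<..n}. x i)"
    by (intro pred_intros_finite) auto
  with True show ?thesis by (simp add: run_completed_at_def)
qed (simp add: run_completed_at_def)

lemma measurable_waiting_time [measurable]:
  "waiting_time k \<in> measurable (bernoulli_trials p) (count_space UNIV)"
  unfolding waiting_time_def[abs_def] by measurable

lemma prob_space_geometric_order: "prob_space (geometric_order k p)"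
  unfolding geometric_order_def
  by (intro prob_space.prob_space_distr prob_space_bernoulli_trials measurable_waiting_time)

lemma prob_all_success:
  assumes "0 \<le> p" "p \<le> 1" "finite S" "S \<subseteq> {1..}"
  shows "measure (bernoulli_trials p) {x \<in> space (bernoulli_trials p). \<forall>i\<in>S. x i} = p ^ card S"
proof -
  interpret product_prob_space "\<lambda>_. measure_pmf (bernoulli_pmf p)" "{1..} :: nat set"
    by unfold_locales
  have "emeasure (bernoulli_trials p) {x \<in> space (bernoulli_trials p). \<forall>i\<in>S. x i \<in> {True}}
      = (\<Prod>i\<in>S. emeasure (measure_pmf (bernoulli_pmf p)) {True})"
    unfolding bernoulli_trials_def using assms by (intro emeasure_PiM_Collect) auto
  also have "\<dots> = ennreal (p ^ card S)"
    using assms by (simp add: emeasure_pmf_single ennreal_power)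
  finally show ?thesis using assms by (simp add: measure_def)
qed

lemma AE_run_completed:
  assumes "0 < p" "p < 1"
  shows "AE x in bernoulli_trials p. \<exists>n. run_completed_at k x n"
proof -
  let ?M = "bernoulli_trials p"
  interpret prob_space ?M by (rule prob_space_bernoulli_trials)
  define B :: "nat \<Rightarrow> nat set" where "B j = {j * k<..Suc j * k}" for j
  define F where "F j = {x \<in> space ?M. run_completed_at k x (Suc j * k)}" for j
  have F_eq: "F j = {x \<in> space ?M. \<forall>i\<in>B j. x i}" for j
    by (auto simp: F_def B_def run_completed_at_def)
  have F_sets [measurable]: "F j \<in> events" for j
    unfolding F_def by measurable
  have prob_F: "prob (F j) = p ^ k" for j
    unfolding F_eq using assms by (subst prob_all_success) (auto simp: B_def)
  have disj: "B i \<inter> B j = {}" if "i < j" for i j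
  proof -
    have "Suc i * k \<le> j * k" using that by (intro mult_right_mono) auto
    then show ?thesis by (auto simp: B_def)
  qed
  have disj': "B i \<inter> B j = {}" if "i \<noteq> j" for i j
    using disj[of i j] disj[of j i] that by (cases "i < j") auto
  have "indep_events F UNIV"
  proof (rule indep_eventsI)
    fix J :: "nat set" assume J: "finite J" "J \<noteq> {}"
    have "(\<Inter>j\<in>J. F j) = {x \<in> space ?M. \<forall>i\<in>(\<Union>j\<in>J. B j). x i}"
      using J by (auto simp: F_eq)
    also have "prob \<dots> = p ^ card (\<Union>j\<in>J. B j)"
      using assms J by (intro prob_all_success) (auto simp: B_def)
    also have "card (\<Union>j\<in>J. B j) = (\<Sum>j\<in>J. card (B j))"
      using J disj' by (intro card_UN_disjoint) (auto simp: B_def)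
    also have "\<dots> = card J * k" by (simp add: B_def)
    finally show "prob (\<Inter>j\<in>J. F j) = (\<Prod>j\<in>J. prob (F j))"
      by (simp add: prob_F power_mult mult.commute)
  qed simp
  then have "indep_sets (\<lambda>j. {F j}) UNIV"
    by (simp add: indep_events_def_alt)
  then have ind: "indep_sets (\<lambda>j. sigma_sets (space ?M) {F j}) UNIV"
    by (rule indep_sets_sigma) (auto simp: Int_stable_def)
  let ?N = "{x \<in> space ?M. \<not> (\<exists>n. run_completed_at k x n)}"
  have bound: "prob ?N \<le> (1 - p ^ k) ^ Suc m" for m
  proof -
    have "prob ?N \<le> prob (\<Inter>j\<in>{..m}. space ?M - F j)"
      by (intro finite_measure_mono) (auto simp: F_def)
    also have "\<dots> = (\<Prod>j\<in>{..m}. prob (space ?M - F j))"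
      by (rule indep_setsD[OF ind]) (auto intro: sigma_sets.intros)
    also have "\<dots> = (1 - p ^ k) ^ Suc m"
      by (simp add: prob_compl prob_F)
    finally show ?thesis .
  qed
  have "(\<lambda>m. (1 - p ^ k) ^ Suc m) \<longlonglongrightarrow> 0"
    using assms by (intro LIMSEQ_Suc LIMSEQ_realpow_zero) (auto simp: power_le_one)
  then have "prob ?N \<le> 0"
    by (rule LIMSEQ_le_const) (use bound in auto)
  then have "prob ?N = 0" using measure_nonneg by (rule antisym)
  then show ?thesis
    by (subst AE_iff_measurable[OF _ refl]) (auto simp: emeasure_eq_measure)
qed

end

theory Submission
  imports Defs
begin

text \<open>
  Write \<open>f n = P (N = n)\<close> and \<open>a = q * p ^ k\<close>. The run is completed for the first time at trial
  \<open>n + k + 1\<close> exactly if no run is completed within the first \<open>n\<close> trials, trial \<open>n + 1\<close> fails, and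
  the next \<open>k\<close> trials succeed. These are conditions on disjoint blocks of trials, and a run is
  almost surely completed at some time, so independence gives the recurrence
  \<open>f (n + k + 1) = a * (\<Sum>m>n. f m)\<close> (lemma \<open>geometric_order_tail_recurrence\<close>).

  This recurrence alone determines all binomial moments. Since \<open>n choose Suc r\<close> is the sum of
  \<open>i choose r\<close> over \<open>i < n\<close>, exchanging the order of summation turns the moment with weights
  \<open>n choose Suc r\<close> into one of the tails of \<open>f\<close> with weights \<open>i choose r\<close>. Multiplied by \<open>a\<close>, the
  tails are again values of \<open>f\<close>, shifted by \<open>k + 1\<close>. Hence each factor \<open>a\<close> lowers the order of the
  moment by one and shifts \<open>f\<close> by \<open>k + 1\<close>; after \<open>r\<close> steps the plain sum of \<open>f\<close> from \<open>r * (k + 1)\<close>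
  on is left, which a last factor \<open>a\<close> turns into the single value \<open>f (r * (k + 1) + k)\<close>
  (lemma \<open>binomial_moment_of_tail_recurrence\<close>). The index is \<open>(r + 1) * k + r\<close>, and multiplication
  by \<open>fact r\<close> passes from binomial to factorial moments.

  All sums are taken in the extended nonnegative reals, where they may be rearranged freely. The
  finiteness of the moments is then a consequence of the identity.
\<close>

section \<open>Binomial moments and tail sums\<close>

lemma suminf_ennreal_tail:
  fixes g :: "nat \<Rightarrow> ennreal"
  shows "(\<Sum>m. g (Suc i + m)) = (\<Sum>n. if i < n then g n else 0)"
proof -
  have "n \<in> range (\<lambda>m. Suc i + m)" if "i < n" for n
    using that by (auto intro: image_eqI[of _ _ "n - Suc i"])
  then have "(\<Sum>m. (\<lambda>n. if i < n then g n else 0) (Suc i + m)) =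
      (\<Sum>n. if i < n then g n else 0)"
    by (intro suminf_mono_reindex) (auto simp: strict_mono_def)
  then show ?thesis by simp
qed

lemma suminf_ennreal_commute:
  fixes h :: "nat \<Rightarrow> nat \<Rightarrow> ennreal"
  shows "(\<Sum>i. \<Sum>n. h i n) = (\<Sum>n. \<Sum>i. h i n)"
proof -
  have "(\<Sum>i. \<Sum>n. h i n) = (\<integral>\<^sup>+n. (\<Sum>i. h i n) \<partial>count_space UNIV)"
    by (subst nn_integral_suminf) (simp_all add: nn_integral_count_space_nat)
  then show ?thesis by (simp add: nn_integral_count_space_nat)
qed

lemma sum_choose_lessThan: "(\<Sum>i<n. i choose r) = n choose Suc r"
  by (induction n) (auto simp: binomial_Suc_Suc)

text \<open>
  Both sides sum \<open>(i choose r) * g n\<close> over all pairs \<open>i < n\<close>; this is the step that trades one order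
  of the moment for a passage to tails.
\<close>

lemma suminf_choose_tail:
  fixes g :: "nat \<Rightarrow> ennreal"
  shows "(\<Sum>i. of_nat (i choose r) * (\<Sum>m. g (Suc i + m))) = (\<Sum>n. of_nat (n choose Suc r) * g n)"
proof -
  have inner: "(\<Sum>i. of_nat (i choose r) * (if i < n then g n else 0)) = of_nat (n choose Suc r) * g n"
    for n
  proof -
    have "(\<Sum>i. of_nat (i choose r) * (if i < n then g n else 0)) =
        (\<Sum>i<n. of_nat (i choose r) * (if i < n then g n else 0))"
      by (rule suminf_finite) auto
    also have "\<dots> = of_nat (\<Sum>i<n. i choose r) * g n"
      by (simp add: sum_distrib_right)
    finally show ?thesis by (simp only: sum_choose_lessThan)
  qed
  have "(\<Sum>i. of_nat (i choose r) * (\<Sum>m. g (Suc i + m))) =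
      (\<Sum>i. \<Sum>n. of_nat (i choose r) * (if i < n then g n else 0))"
    by (simp only: suminf_ennreal_tail ennreal_suminf_cmult)
  also have "\<dots> = (\<Sum>n. \<Sum>i. of_nat (i choose r) * (if i < n then g n else 0))"
    by (rule suminf_ennreal_commute)
  finally show ?thesis by (simp only: inner)
qed

text \<open>
  The shift \<open>j\<close> is what makes the induction on \<open>r\<close> work: one step replaces \<open>j\<close> by \<open>j + k + 1\<close>. The
  recurrence describes only tails that start at an index of at least \<open>1\<close>. The last tail to be
  resolved starts at \<open>j + r * (k + 1)\<close>, so \<open>j\<close> and \<open>r\<close> must not both vanish.
\<close>

lemma binomial_moment_of_tail_recurrence:
  fixes f :: "nat \<Rightarrow> ennreal" and a :: ennreal
  assumes rec: "\<And>n. f (n + k + 1) = a * (\<Sum>m. f (Suc n + m))"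
    and pos: "0 < j + r"
  shows "a ^ (r + 1) * (\<Sum>n. of_nat (n choose r) * f (n + j)) = f (j + r * (k + 1) + k)"
  using pos
proof (induction r arbitrary: j)
  case 0
  then obtain i where "j = Suc i" by (cases j) auto
  then show ?case using rec[of i] by (simp add: ac_simps)
next
  case (Suc r)
  have "a * (\<Sum>n. of_nat (n choose Suc r) * f (n + j)) =
      a * (\<Sum>i. of_nat (i choose r) * (\<Sum>m. f (Suc i + m + j)))"
    by (subst suminf_choose_tail[where g = "\<lambda>n. f (n + j)"]) (rule refl)
  also have "\<dots> = (\<Sum>i. of_nat (i choose r) * (a * (\<Sum>m. f (Suc (i + j) + m))))"
    by (subst ennreal_suminf_cmult[symmetric]) (simp add: ac_simps)
  also have "\<dots> = (\<Sum>i. of_nat (i choose r) * f (i + (j + k + 1)))"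
    by (simp only: rec[symmetric]) (simp add: ac_simps)
  finally have "a ^ (Suc r + 1) * (\<Sum>n. of_nat (n choose Suc r) * f (n + j)) =
      a ^ (r + 1) * (\<Sum>i. of_nat (i choose r) * f (i + (j + k + 1)))"
    by (simp only: add_Suc power_Suc2 mult.assoc)
  also have "\<dots> = f (j + k + 1 + r * (k + 1) + k)"
    by (rule Suc.IH) simp
  finally show ?case by (simp add: algebra_simps)
qed

section \<open>Independence of disjoint blocks of trials\<close>

lemma indep_vars_bernoulli_trials:
  "prob_space.indep_vars (bernoulli_trials p)
     (\<lambda>_. measure_pmf (bernoulli_pmf p)) (\<lambda>i x. x i) {1..}"
proof -
  interpret prob_space "bernoulli_trials p" by (rule prob_space_bernoulli_trials)
  let ?B = "\<lambda>_::nat. measure_pmf (bernoulli_pmf p)"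
  have rv: "random_variable (?B i) (\<lambda>x. x i)" if "i \<in> {1..}" for i
    unfolding bernoulli_trials_def using that by (intro measurable_component_singleton)
  have comp: "distr (bernoulli_trials p) (?B i) (\<lambda>x. x i) = ?B i" if "i \<in> {1..}" for i
    unfolding bernoulli_trials_def using that
    by (intro distr_PiM_component) (auto intro: measure_pmf.prob_space_axioms)
  have "distr (bernoulli_trials p) (PiM {1..} ?B) (\<lambda>x. restrict x {1..}) =
      distr (bernoulli_trials p) (bernoulli_trials p) (\<lambda>x. x)"
    by (intro distr_cong) (auto simp: bernoulli_trials_def space_PiM PiE_restrict)
  also have "\<dots> = PiM {1..} (\<lambda>i. distr (bernoulli_trials p) (?B i) (\<lambda>x. x i))"
    unfolding bernoulli_trials_def[symmetric, of p] distr_id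
    by (subst bernoulli_trials_def, rule PiM_cong) (use comp in auto)
  finally show ?thesis
    by (subst indep_vars_iff_distr_eq_PiM') (use rv in auto)
qed

lemma prob_disjoint_trials:
  assumes "A \<subseteq> {1..}" "B \<subseteq> {1..}" "A \<inter> B = {}"
    and P: "Measurable.pred (PiM A (\<lambda>_. measure_pmf (bernoulli_pmf p))) P"
    and Q: "Measurable.pred (PiM B (\<lambda>_. measure_pmf (bernoulli_pmf p))) Q"
  shows "measure (bernoulli_trials p)
      {x \<in> space (bernoulli_trials p). P (restrict x A) \<and> Q (restrict x B)} =
    measure (bernoulli_trials p) {x \<in> space (bernoulli_trials p). P (restrict x A)} *
    measure (bernoulli_trials p) {x \<in> space (bernoulli_trials p). Q (restrict x B)}"
proof -
  interpret prob_space "bernoulli_trials p" by (rule prob_space_bernoulli_trials)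
  let ?A = "PiM A (\<lambda>_. measure_pmf (bernoulli_pmf p))"
  let ?B = "PiM B (\<lambda>_. measure_pmf (bernoulli_pmf p))"
  let ?S = "{y \<in> space ?A. P y}" and ?T = "{y \<in> space ?B. Q y}"
  have ind: "indep_var ?A (\<lambda>x. restrict (\<lambda>i. x i) A) ?B (\<lambda>x. restrict (\<lambda>i. x i) B)"
    using assms by (intro indep_var_restrict[OF indep_vars_bernoulli_trials]) auto
  have [simp]: "restrict x C \<in> space (PiM C (\<lambda>_. measure_pmf (bernoulli_pmf p)))" for x C
    by (simp add: space_PiM)
  have "prob ((\<lambda>x. (restrict x A, restrict x B)) -` (?S \<times> ?T) \<inter> space (bernoulli_trials p)) =
      prob ((\<lambda>x. restrict x A) -` ?S \<inter> space (bernoulli_trials p)) *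
      prob ((\<lambda>x. restrict x B) -` ?T \<inter> space (bernoulli_trials p))"
    using indep_varD[OF ind, of ?S ?T] P Q by (simp add: pred_def)
  then show ?thesis
    by (simp add: vimage_def Int_def conj_commute)
qed

text \<open>
  The event is the difference of the events that trials \<open>n + 2, \<dots>, n + k + 1\<close> and that trials
  \<open>n + 1, \<dots>, n + k + 1\<close> all succeed, so its probability is \<open>p ^ k - p ^ (k + 1)\<close>.
\<close>

lemma prob_failure_then_successes:
  assumes "0 \<le> p" "p \<le> 1"
  shows "measure (bernoulli_trials p)
      {x \<in> space (bernoulli_trials p). \<not> x (n + 1) \<and> (\<forall>i\<in>{n + 1<..n + k + 1}. x i)} = (1 - p) * p ^ k"
proof -
  interpret prob_space "bernoulli_trials p" by (rule prob_space_bernoulli_trials)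
  let ?E = "\<lambda>S. {x \<in> space (bernoulli_trials p). \<forall>i\<in>S. x i}"
  let ?L = "{n + 1<..n + k + 1}" and ?U = "{n<..n + k + 1}"
  have E: "?E S \<in> events" if "finite S" "S \<subseteq> {1..}" for S
  proof -
    have "Measurable.pred (bernoulli_trials p) (\<lambda>x. x i)" if "i \<in> S" for i
    proof -
      have "(\<lambda>x. x i) \<in> measurable (bernoulli_trials p) (measure_pmf (bernoulli_pmf p))"
        unfolding bernoulli_trials_def using that \<open>S \<subseteq> {1..}\<close>
        by (intro measurable_component_singleton) auto
      then show ?thesis by simp
    qed
    then have "Measurable.pred (bernoulli_trials p) (\<lambda>x. \<forall>i\<in>S. x i)"
      using \<open>finite S\<close> by (intro pred_intros_finite) auto
    then show ?thesis by (simp add: pred_def)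
  qed
  have U: "?U = insert (n + 1) ?L" by auto
  have diff: "{x \<in> space (bernoulli_trials p). \<not> x (n + 1) \<and> (\<forall>i\<in>?L. x i)} = ?E ?L - ?E ?U"
    unfolding U by auto
  have "prob (?E ?L - ?E ?U) = prob (?E ?L) - prob (?E ?U)"
    by (intro finite_measure_Diff E) (auto simp: U)
  also have "\<dots> = p ^ k - p ^ (k + 1)"
    using prob_all_success[OF assms, of ?L] prob_all_success[OF assms, of ?U]
    by (simp add: subset_eq)
  finally show ?thesis unfolding diff by (simp add: algebra_simps)
qed

section \<open>The recurrence for the waiting time\<close>

lemma run_completed_at_restrict:
  assumes "1 \<le> k" "m \<le> n"
  shows "run_completed_at k (restrict x {1..n}) m \<longleftrightarrow> run_completed_at k x m"
  using assms by (auto simp: run_completed_at_def)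

lemma waiting_time_eq_iff:
  assumes "1 \<le> k" "0 < n"
  shows "waiting_time k x = n \<longleftrightarrow> run_completed_at k x n \<and> (\<forall>m<n. \<not> run_completed_at k x m)"
proof
  assume eq: "waiting_time k x = n"
  then have ex: "\<exists>n. run_completed_at k x n"
    using \<open>0 < n\<close> by (auto simp: waiting_time_def split: if_splits)
  with eq have n: "n = (LEAST n. run_completed_at k x n)"
    by (simp add: waiting_time_def)
  show "run_completed_at k x n \<and> (\<forall>m<n. \<not> run_completed_at k x m)"
    using LeastI_ex[OF ex] not_less_Least[of _ "run_completed_at k x"] unfolding n by blast
next
  assume "run_completed_at k x n \<and> (\<forall>m<n. \<not> run_completed_at k x m)"
  then show "waiting_time k x = n"
    unfolding waiting_time_def by (metis Least_equality not_less)
qed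

text \<open>
  Trial \<open>n + 1\<close> must fail, since otherwise a run would already be completed at \<open>n + k\<close>. Conversely,
  if it fails, no run is completed at any of the times \<open>n + 1, \<dots>, n + k\<close>, because each such run
  would contain trial \<open>n + 1\<close>.
\<close>

lemma waiting_time_late_iff:
  assumes "1 \<le> k"
  shows "waiting_time k x = n + k + 1 \<longleftrightarrow>
    (\<forall>m\<le>n. \<not> run_completed_at k x m) \<and> \<not> x (n + 1) \<and> (\<forall>i\<in>{n + 1<..n + k + 1}. x i)"
    (is "?L \<longleftrightarrow> ?R")
proof
  assume ?L
  then have run: "run_completed_at k x (n + k + 1)"
    and no: "\<And>m. m < n + k + 1 \<Longrightarrow> \<not> run_completed_at k x m"
    using waiting_time_eq_iff[OF assms, of "n + k + 1" x] by simp_all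
  have succ: "\<forall>i\<in>{n + 1<..n + k + 1}. x i"
    using run by (auto simp: run_completed_at_def)
  moreover have "\<not> x (n + 1)"
  proof
    assume x: "x (n + 1)"
    have "x i" if "n < i" "i \<le> n + k" for i
      using that succ x by (cases "i = n + 1") auto
    then have "run_completed_at k x (n + k)" by (auto simp: run_completed_at_def)
    then show False using no[of "n + k"] by simp
  qed
  ultimately show ?R using no by simp
next
  assume R: ?R
  have "\<not> run_completed_at k x m" if "m < n + k + 1" for m
  proof (cases "m \<le> n")
    case False
    with that have "n + 1 \<in> {m - k<..m}" by auto
    then show ?thesis using R by (auto simp: run_completed_at_def)
  qed (use R in simp)
  moreover have "run_completed_at k x (n + k + 1)"
    using R by (auto simp: run_completed_at_def)
  ultimately show ?L using assms by (subst waiting_time_eq_iff) auto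
qed

text \<open>
  In the description of the event above, the first condition concerns only trials \<open>1, \<dots>, n\<close> and the
  other two only trials \<open>n + 1, \<dots>, n + k + 1\<close>, so the probabilities multiply.
\<close>

lemma prob_waiting_time_late:
  assumes "1 \<le> k" "0 < p" "p < 1"
  shows "measure (geometric_order k p) {n + k + 1} =
    (1 - p) * p ^ k * measure (geometric_order k p) {n<..}"
proof -
  let ?M = "bernoulli_trials p"
  interpret prob_space ?M by (rule prob_space_bernoulli_trials)
  let ?P = "\<lambda>x. \<forall>m\<le>n. \<not> run_completed_at k x m"
  let ?Q = "\<lambda>x. \<not> x (n + 1) \<and> (\<forall>i\<in>{n + 1<..n + k + 1}. x i)"
  let ?A = "{1..n}" and ?B = "{n<..n + k + 1}"
  have coord: "Measurable.pred (PiM C (\<lambda>_. measure_pmf (bernoulli_pmf p))) (\<lambda>x. x i)"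
    if "i \<in> C" for C :: "nat set" and i
  proof -
    have "(\<lambda>x. x i) \<in> measurable (PiM C (\<lambda>_. measure_pmf (bernoulli_pmf p)))
        (measure_pmf (bernoulli_pmf p))"
      using that by (intro measurable_component_singleton)
    then show ?thesis by simp
  qed
  have P: "Measurable.pred (PiM ?A (\<lambda>_. measure_pmf (bernoulli_pmf p))) ?P"
  proof -
    have "Measurable.pred (PiM ?A (\<lambda>_. measure_pmf (bernoulli_pmf p)))
        (\<lambda>x. run_completed_at k x m)" if "m \<in> {..n}" for m
      using that unfolding run_completed_at_def
      by (intro pred_intros_logic pred_intros_finite coord) auto
    then have "Measurable.pred (PiM ?A (\<lambda>_. measure_pmf (bernoulli_pmf p)))
        (\<lambda>x. \<forall>m\<in>{..n}. \<not> run_completed_at k x m)"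
      by (intro pred_intros_finite pred_intros_logic) auto
    then show ?thesis by (simp only: Ball_def atMost_iff)
  qed
  have Q: "Measurable.pred (PiM ?B (\<lambda>_. measure_pmf (bernoulli_pmf p))) ?Q"
    by (intro pred_intros_logic pred_intros_finite coord) auto
  have PA: "?P (restrict x ?A) \<longleftrightarrow> ?P x" for x
    using run_completed_at_restrict[OF \<open>1 \<le> k\<close>, of _ n x] by blast
  have QB: "?Q (restrict x ?B) \<longleftrightarrow> ?Q x" for x by auto
  \<comment> \<open>Only almost surely: \<open>waiting_time\<close> is \<open>0\<close>, not infinite, on sequences without a run.\<close>
  have tail: "prob {x \<in> space ?M. ?P x} = prob {x \<in> space ?M. n < waiting_time k x}"
  proof (rule prob_eq_AE)
    show "AE x in ?M. ?P x \<longleftrightarrow> n < waiting_time k x"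
      using AE_run_completed[OF \<open>0 < p\<close> \<open>p < 1\<close>, of k]
    proof eventually_elim
      case (elim x)
      then have "waiting_time k x = (LEAST n. run_completed_at k x n)"
        by (simp add: waiting_time_def)
      then have wait: "run_completed_at k x (waiting_time k x)"
          "\<And>m. run_completed_at k x m \<Longrightarrow> waiting_time k x \<le> m"
        using LeastI_ex[OF elim] Least_le[of "run_completed_at k x"] by simp_all
      show ?case
        using wait by (meson le_trans not_less)
    qed
  qed measurable
  have "measure (geometric_order k p) {n + k + 1} =
      prob {x \<in> space ?M. waiting_time k x = n + k + 1}"
    unfolding geometric_order_def by (subst measure_distr) (auto intro!: arg_cong[where f = prob])
  also have "\<dots> = prob {x \<in> space ?M. ?P (restrict x ?A) \<and> ?Q (restrict x ?B)}"
    unfolding PA QB waiting_time_late_iff[OF \<open>1 \<le> k\<close>] ..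
  also have "\<dots> = prob {x \<in> space ?M. ?P x} * prob {x \<in> space ?M. ?Q x}"
    by (subst prob_disjoint_trials[OF _ _ _ P Q]) (auto simp only: PA QB, auto)
  also have "prob {x \<in> space ?M. ?Q x} = (1 - p) * p ^ k"
    using assms by (intro prob_failure_then_successes) auto
  also have "prob {x \<in> space ?M. ?P x} = measure (geometric_order k p) {n<..}"
    unfolding tail geometric_order_def
    by (subst measure_distr) (auto intro!: arg_cong[where f = prob])
  finally show ?thesis by (simp only: mult.commute)
qed

lemma geometric_order_tail_recurrence:
  assumes "1 \<le> k" "0 < p" "p < 1"
  shows "emeasure (geometric_order k p) {n + k + 1} =
    ennreal ((1 - p) * p ^ k) * (\<Sum>m. emeasure (geometric_order k p) {Suc n + m})"
proof -
  interpret prob_space "geometric_order k p" by (rule prob_space_geometric_order)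
  \<comment> \<open>The sum is the probability of \<open>{n<..}\<close>, decomposed into its points.\<close>
  have "range (\<lambda>m. {Suc n + m}) \<subseteq> events"
    by (auto simp: geometric_order_def)
  then have "(\<Sum>m. emeasure (geometric_order k p) {Suc n + m}) =
      emeasure (geometric_order k p) (\<Union>m. {Suc n + m})"
    by (intro suminf_emeasure) (auto simp: disjoint_family_on_def)
  also have "(\<Union>m. {Suc n + m}) = {n<..}"
    by (auto simp: Suc_le_eq dest!: less_imp_Suc_add)
  finally show ?thesis
    using assms prob_waiting_time_late[OF assms, of n]
    by (simp add: emeasure_eq_measure ennreal_mult)
qed

section \<open>Factorial moments\<close>

lemma prod_falling_eq_fact_binomial:
  "(\<Prod>i<r. real n - real i) = fact r * real (n choose r)"
  using gbinomial_mult_fact[of r "real n"] by (simp add: atLeast0LessThan binomial_gbinomial)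

lemma nn_integral_nat:
  fixes h :: "nat \<Rightarrow> ennreal"
  assumes "sets M = UNIV"
  shows "(\<integral>\<^sup>+n. h n \<partial>M) = (\<Sum>n. h n * emeasure M {n})"
proof -
  have meas: "h' \<in> borel_measurable M" for h' :: "nat \<Rightarrow> ennreal"
    using assms by (auto simp: measurable_def)
  have "(\<Sum>n. h n * indicator {n} m) = h m" for m
    by (subst suminf_finite[of "{m}"]) auto
  then have "(\<integral>\<^sup>+n. h n \<partial>M) = (\<integral>\<^sup>+m. (\<Sum>n. h n * indicator {n} m) \<partial>M)"
    by simp
  also have "\<dots> = (\<Sum>n. \<integral>\<^sup>+m. h n * indicator {n} m \<partial>M)"
    by (rule nn_integral_suminf) (rule meas)
  also have "\<dots> = (\<Sum>n. h n * emeasure M {n})"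
    using assms by (intro suminf_cong nn_integral_cmult_indicator) auto
  finally show ?thesis .
qed

theorem proposition1:
  fixes k r :: nat and p q :: real and M :: "'a measure" and N :: "'a \<Rightarrow> nat"
  assumes "k \<ge> 1" and "0 < p" and "p < 1" and "q = 1 - p"
    and "prob_space M"
    and "N \<in> measurable M (count_space UNIV)"
    and "distr M (count_space UNIV) N = geometric_order k p"
    and "r \<ge> 1"
  shows "factorial_moment M N r =
    fact r * measure M {\<omega> \<in> space M. N \<omega> = (r + 1) * k + r} / (q * p ^ k) ^ (r + 1)"
proof -
  let ?G = "geometric_order k p" and ?n = "(r + 1) * k + r"
  let ?a = "q * p ^ k"
  interpret G: prob_space ?G by (rule prob_space_geometric_order)
  have sets_G: "sets ?G = UNIV" by (simp add: geometric_order_def)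
  have pos: "0 < ?a" using assms by simp
  have meas: "h \<in> borel_measurable ?G" for h :: "nat \<Rightarrow> real"
    using sets_G by (auto simp: measurable_def)
  \<comment> \<open>The case \<open>j = 0\<close> of \<open>binomial_moment_of_tail_recurrence\<close>, which needs \<open>r \<ge> 1\<close>.\<close>
  have "ennreal (?a ^ (r + 1)) * (\<integral>\<^sup>+n. ennreal (real (n choose r)) \<partial>?G) =
      ennreal ?a ^ (r + 1) * (\<Sum>n. of_nat (n choose r) * emeasure ?G {n + 0})"
    using pos by (simp add: nn_integral_nat[OF sets_G] ennreal_power ennreal_of_nat_eq_real_of_nat
        del: power_Suc)
  also have "\<dots> = emeasure ?G {0 + r * (k + 1) + k}"
    using geometric_order_tail_recurrence[OF assms(1-3)] \<open>r \<ge> 1\<close> \<open>q = 1 - p\<close>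
    by (intro binomial_moment_of_tail_recurrence[where f = "\<lambda>n. emeasure ?G {n}"]) auto
  also have "\<dots> = ennreal (measure ?G {?n})"
    by (simp add: G.emeasure_eq_measure algebra_simps)
  finally have "enn2real (ennreal (?a ^ (r + 1)) * (\<integral>\<^sup>+n. ennreal (real (n choose r)) \<partial>?G)) =
      measure ?G {?n}"
    by simp
  moreover have "(\<integral>n. real (n choose r) \<partial>?G) = enn2real (\<integral>\<^sup>+n. ennreal (real (n choose r)) \<partial>?G)"
    by (rule integral_eq_nn_integral) (auto intro: meas)
  ultimately have moment: "?a ^ (r + 1) * (\<integral>n. real (n choose r) \<partial>?G) = measure ?G {?n}"
    using pos by (simp add: enn2real_mult del: power_Suc)
  have "factorial_moment M N r = (\<integral>\<omega>. fact r * real (N \<omega> choose r) \<partial>M)"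
    by (simp add: factorial_moment_def prod_falling_eq_fact_binomial)
  also have "\<dots> = fact r * (\<integral>n. real (n choose r) \<partial>distr M (count_space UNIV) N)"
    using \<open>N \<in> measurable M (count_space UNIV)\<close> by (simp add: integral_distr)
  also have "\<dots> = fact r * measure ?G {?n} / ?a ^ (r + 1)"
    unfolding \<open>distr M (count_space UNIV) N = ?G\<close> moment[symmetric]
    using assms by simp
  also have "measure ?G {?n} = measure M {\<omega> \<in> space M. N \<omega> = ?n}"
    unfolding \<open>distr M (count_space UNIV) N = ?G\<close>[symmetric]
    using \<open>N \<in> measurable M (count_space UNIV)\<close>
    by (subst measure_distr) (auto intro!: arg_cong[where f = "measure M"])
  finally show ?thesis .
qed

end
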